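(* Let $k\ge 2$ be an integer and let $n=2k-1$. Then the adjacency spectrum of the line graph $L(BL_n(k-1,k))$ consists of exactly the following eigenvalues with the following multiplicities: \begin{itemize} \item $-2$, with multiplicity $(k-2)\binom{2k-1}{k-1}+1$; \item $i-2$, for each $i=1,2,\ldots,k-1$, with multiplicity $\binom{2k-1}{i}-\binom{2k-1}{i-1}$; \item $2k-i-2$, for each $i=0,1,\ldots,k-1$, with multiplicity $\binom{2k-1}{i}-\binom{2k-1}{i-1}$. \end{itemize}
   Context: Let $[n]=\{1,\ldots,n\}$. For $n\ge 3$, the Boolean lattice $BL_n$ is the graph whose vertices are all subsets of $[n]$, two subsets being adjacent if and only if their symmetric difference has exactly one element. $BL_n(k-1,k)$ is the induced subgraph of $BL_n$ on the set of all $(k-1)$-element subsets and all $k$-element subsets of $[n]$; that is, it is the bipartite graph in which a $(k-1)$-subset $U$ is adjacent to a $k$-subset $W$ if and only if $U\subset W$. The line graph $L(\Gamma)$ of a graph $\Gamma$ has as vertices the edges of $\Gamma$, two distinct edges being adjacent if and only if they share an endpoint. The spectrum of a graph is the multiset of eigenvalues of its adjacency matrix. Convention: $\binom{n}{-1}=0$. *)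

theory Defs
  imports "Jordan_Normal_Form.Char_Poly"
begin

text \<open>A simple graph is a pair of a vertex set and a set of two-element sets of vertices.\<close>

type_synonym 'a graph = "'a set \<times> 'a set set"

definition vertices :: "'a graph \<Rightarrow> 'a set" where
  "vertices G = fst G"

definition edges :: "'a graph \<Rightarrow> 'a set set" where
  "edges G = snd G"

definition adjacent :: "'a graph \<Rightarrow> 'a \<Rightarrow> 'a \<Rightarrow> bool" where
  "adjacent G u v \<longleftrightarrow> {u, v} \<in> edges G"

definition induced_subgraph :: "'a graph \<Rightarrow> 'a set \<Rightarrow> 'a graph" where
  "induced_subgraph G S = (vertices G \<inter> S, {e \<in> edges G. e \<subseteq> S})"

definition line_graph :: "'a graph \<Rightarrow> 'a set graph" where
  "line_graph G =
    (edges G, {{e, f} | e f. e \<in> edges G \<and> f \<in> edges G \<and> e \<noteq> f \<and> e \<inter> f \<noteq> {}})"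

definition boolean_lattice :: "nat \<Rightarrow> nat set graph" where
  "boolean_lattice n =
    (Pow {1..n},
     {{U, W} | U W. U \<subseteq> {1..n} \<and> W \<subseteq> {1..n} \<and> card (sym_diff U W) = 1})"

definition boolean_layers :: "nat \<Rightarrow> nat \<Rightarrow> nat \<Rightarrow> nat set graph" where
  "boolean_layers n a b =
    induced_subgraph (boolean_lattice n) {U. U \<subseteq> {1..n} \<and> (card U = a \<or> card U = b)}"

definition enumerates :: "'a list \<Rightarrow> 'a set \<Rightarrow> bool" where
  "enumerates vs V \<longleftrightarrow> distinct vs \<and> set vs = V"

definition adjacency_matrix :: "'a graph \<Rightarrow> 'a list \<Rightarrow> complex mat" where
  "adjacency_matrix G vs =
    mat (length vs) (length vs) (\<lambda>(i, j). if adjacent G (vs ! i) (vs ! j) then 1 else 0)"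

text \<open>
  The eigenvalues are counted with algebraic multiplicity. The matrix is taken over the complex
  numbers, so that no eigenvalue can be missed. The choice of the enumeration is immaterial, see
  \<open>graph_spectrum_eq\<close> below.
\<close>

definition graph_spectrum :: "'a graph \<Rightarrow> complex multiset" where
  "graph_spectrum G =
    proots (char_poly (adjacency_matrix G (SOME vs. enumerates vs (vertices G))))"

text \<open>Binomial coefficients with an integer lower index, which vanish if that index is negative.\<close>

definition binom :: "nat \<Rightarrow> int \<Rightarrow> nat" where
  "binom n j = (if j < 0 then 0 else n choose nat j)"

lemma sum_enumerates:
  assumes "enumerates vs V"
  shows "(\<Sum>j = 0..<length vs. g (vs ! j)) = sum g V"
proof -
  have "sum g V = sum_list (map g vs)"
    using assms by (auto simp: enumerates_def sum_list_distinct_conv_sum_set)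
  then show ?thesis by (simp add: sum_list_sum_nth)
qed

lemma similar_adjacency_matrix:
  assumes vs: "enumerates vs V" and ws: "enumerates ws V"
  shows "similar_mat (adjacency_matrix G vs) (adjacency_matrix G ws)"
proof -
  define n where "n = length vs"
  have len: "length ws = n"
    using vs ws distinct_card[of vs] distinct_card[of ws] unfolding enumerates_def n_def by simp
  have fin: "finite V" using vs by (auto simp: enumerates_def)
  have vV: "vs ! i \<in> V" if "i < n" for i
    using nth_mem[of i vs] vs that unfolding enumerates_def n_def by simp
  define M :: "'a list \<Rightarrow> 'a list \<Rightarrow> complex mat" where
    "M xs ys = mat n n (\<lambda>(i, j). if xs ! i = ys ! j then 1 else 0)" for xs ys
  let ?adj = "\<lambda>u v. if adjacent G u v then 1 else (0 :: complex)"
  have A: "adjacency_matrix G vs = mat n n (\<lambda>(i, j). ?adj (vs ! i) (vs ! j))"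
    and B: "adjacency_matrix G ws = mat n n (\<lambda>(i, j). ?adj (ws ! i) (ws ! j))"
    unfolding adjacency_matrix_def len n_def[symmetric] by (rule refl)+
  have inv: "M xs ys * M ys xs = 1\<^sub>m n"
    if xs: "enumerates xs V" "length xs = n" and ys: "enumerates ys V" "length ys = n" for xs ys
  proof (rule eq_matI)
    fix i j assume "i < dim_row (1\<^sub>m n :: complex mat)" "j < dim_col (1\<^sub>m n :: complex mat)"
    then have ij: "i < n" "j < n" by auto
    have xV: "xs ! i \<in> V"
      using nth_mem[of i xs] xs ij unfolding enumerates_def by simp
    have "(M xs ys * M ys xs) $$ (i, j)
        = (\<Sum>l = 0..<length ys. (if xs ! i = ys ! l then 1 else 0) * (if ys ! l = xs ! j then 1 else 0))"
      using ij ys by (auto simp: M_def scalar_prod_def intro!: sum.cong)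
    also have "\<dots> = (\<Sum>y\<in>V. (if xs ! i = y then 1 else 0) * (if y = xs ! j then 1 else 0))"
      by (rule sum_enumerates[OF ys(1)])
    also have "\<dots> = (\<Sum>y\<in>V. if xs ! i = y then (if xs ! i = xs ! j then 1 else 0) else 0)"
      by (rule sum.cong) auto
    also have "\<dots> = (if xs ! i = xs ! j then 1 else 0)"
      using fin xV by (simp add: sum.delta)
    also have "\<dots> = 1\<^sub>m n $$ (i, j)"
      using xs ij by (auto simp: enumerates_def nth_eq_iff_index_eq)
    finally show "(M xs ys * M ys xs) $$ (i, j) = 1\<^sub>m n $$ (i, j)" .
  qed (auto simp: M_def)
  have PB: "M vs ws * adjacency_matrix G ws = mat n n (\<lambda>(i, j). ?adj (vs ! i) (ws ! j))"
  proof (rule eq_matI)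
    fix i j
    assume "i < dim_row (mat n n (\<lambda>(i, j). ?adj (vs ! i) (ws ! j)))"
      "j < dim_col (mat n n (\<lambda>(i, j). ?adj (vs ! i) (ws ! j)))"
    then have ij: "i < n" "j < n" by auto
    have "(M vs ws * adjacency_matrix G ws) $$ (i, j)
        = (\<Sum>l = 0..<length ws. (if vs ! i = ws ! l then 1 else 0) * ?adj (ws ! l) (ws ! j))"
      using ij len by (auto simp: B M_def scalar_prod_def intro!: sum.cong)
    also have "\<dots> = (\<Sum>y\<in>V. (if vs ! i = y then 1 else 0) * ?adj y (ws ! j))"
      by (rule sum_enumerates[OF ws])
    also have "\<dots> = (\<Sum>y\<in>V. if vs ! i = y then ?adj (vs ! i) (ws ! j) else 0)"
      by (rule sum.cong) auto
    also have "\<dots> = ?adj (vs ! i) (ws ! j)"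
      using fin vV[OF ij(1)] by (simp add: sum.delta)
    finally show "(M vs ws * adjacency_matrix G ws) $$ (i, j)
        = mat n n (\<lambda>(i, j). ?adj (vs ! i) (ws ! j)) $$ (i, j)" using ij by simp
  qed (auto simp: M_def B)
  have PBQ: "M vs ws * adjacency_matrix G ws * M ws vs = adjacency_matrix G vs"
    unfolding PB
  proof (rule eq_matI)
    fix i j
    assume "i < dim_row (adjacency_matrix G vs)" "j < dim_col (adjacency_matrix G vs)"
    then have ij: "i < n" "j < n" by (auto simp: A)
    have "(mat n n (\<lambda>(i, j). ?adj (vs ! i) (ws ! j)) * M ws vs) $$ (i, j)
        = (\<Sum>l = 0..<length ws. ?adj (vs ! i) (ws ! l) * (if ws ! l = vs ! j then 1 else 0))"
      using ij len by (auto simp: M_def scalar_prod_def intro!: sum.cong)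
    also have "\<dots> = (\<Sum>y\<in>V. ?adj (vs ! i) y * (if y = vs ! j then 1 else 0))"
      by (rule sum_enumerates[OF ws])
    also have "\<dots> = (\<Sum>y\<in>V. if vs ! j = y then ?adj (vs ! i) (vs ! j) else 0)"
      by (rule sum.cong) auto
    also have "\<dots> = ?adj (vs ! i) (vs ! j)"
      using fin vV[OF ij(2)] by (simp add: sum.delta)
    finally show "(mat n n (\<lambda>(i, j). ?adj (vs ! i) (ws ! j)) * M ws vs) $$ (i, j)
        = adjacency_matrix G vs $$ (i, j)" using ij by (simp add: A)
  qed (auto simp: M_def A)
  show ?thesis
  proof (rule similar_matI[of _ _ "M vs ws" "M ws vs" n])
    show "{adjacency_matrix G vs, adjacency_matrix G ws, M vs ws, M ws vs} \<subseteq> carrier_mat n n"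
      unfolding A B M_def by simp
    show "M vs ws * M ws vs = 1\<^sub>m n" "M ws vs * M vs ws = 1\<^sub>m n"
      using inv vs ws len n_def by simp_all
  qed (rule PBQ[symmetric])
qed

lemma graph_spectrum_eq:
  assumes "enumerates vs (vertices G)"
  shows "graph_spectrum G = proots (char_poly (adjacency_matrix G vs))"
  using char_poly_similar[OF similar_adjacency_matrix[OF
      someI[of "\<lambda>vs. enumerates vs (vertices G)", OF assms] assms, of G]]
  unfolding graph_spectrum_def by simp

end

theory Submission
  imports Defs
begin

text \<open>
  The whole spectrum is computed with characteristic polynomials; no eigenvector is needed. The
  tool is the identity \<open>X\<^sup>m \<chi>(AB) = X\<^sup>n \<chi>(BA)\<close> for \<open>A\<close> of size \<open>n \<times> m\<close> and \<open>B\<close> of size \<open>m \<times> n\<close>.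

  Let \<open>U\<^sub>i\<close> be the inclusion matrix between the \<open>i\<close>-subsets and the \<open>(i+1)\<close>-subsets. Counting common
  neighbours gives \<open>U\<^sub>i U\<^sub>i\<^sup>T = U\<^sub>i\<^sub>-\<^sub>1\<^sup>T U\<^sub>i\<^sub>-\<^sub>1 + (n - 2i) I\<close>, so swapping the factors and shifting determines
  \<open>\<chi>(U\<^sub>i U\<^sub>i\<^sup>T)\<close> by induction on \<open>i\<close>: its roots are \<open>(i - j + 1)(n - i - j)\<close> for \<open>j \<le> i\<close>, with multiplicity
  \<open>C(n, j) - C(n, j-1)\<close>. For \<open>n = 2k - 1\<close> and \<open>i = k - 1\<close> they are the squares \<open>(k - j)\<^sup>2\<close>.

  If \<open>B\<close> is the vertex-edge incidence matrix of the \<open>k\<close>-regular graph on the two middle layers, then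
  \<open>B\<^sup>T B\<close> is the adjacency matrix of the line graph plus \<open>2I\<close>, whereas \<open>B B\<^sup>T\<close> consists of the blocks
  \<open>k I\<close>, \<open>U\<close>, \<open>U\<^sup>T\<close>, \<open>k I\<close> with \<open>U = U\<^sub>k\<^sub>-\<^sub>1\<close>, so that its characteristic polynomial is \<open>\<chi>(U U\<^sup>T)\<close>
  evaluated at \<open>(X - k)\<^sup>2\<close>.
\<close>

section \<open>Characteristic polynomials of products and of block matrices\<close>

lemma poly_char_poly:
  fixes A :: "'a :: field mat"
  assumes "A \<in> carrier_mat n n"
  shows "poly (char_poly A) x = det (x \<cdot>\<^sub>m 1\<^sub>m n - A)"
proof -
  have "- char_matrix A x = x \<cdot>\<^sub>m 1\<^sub>m n - A"
    using assms by (intro eq_matI) (auto simp: char_matrix_def)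
  then show ?thesis using char_poly_matrix[OF assms, of x] by simp
qed

text \<open>Both sides are read off from the block matrix with rows \<open>(x I, A)\<close> and \<open>(B, I)\<close>.\<close>

lemma det_smult_one_minus_mult_commute:
  fixes A B :: "'a :: field mat"
  assumes A: "A \<in> carrier_mat n m" and B: "B \<in> carrier_mat m n"
  shows "x ^ m * det (x \<cdot>\<^sub>m 1\<^sub>m n - A * B) = x ^ n * det (x \<cdot>\<^sub>m 1\<^sub>m m - B * A)"
proof -
  let ?M = "four_block_mat (x \<cdot>\<^sub>m 1\<^sub>m n) A B (1\<^sub>m m)"
  \<comment> \<open>Multiplying \<open>?M\<close> by \<open>?R\<close> on the right or by
    \<open>?L\<close> on the left clears its lower left block. The block x I of \<open>?L\<close>
    matches the corner of \<open>?M\<close>, so no division by x is needed; it contributes the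
    factor x^m.\<close>
  let ?R = "four_block_mat (1\<^sub>m n) (0\<^sub>m n m) (- B) (1\<^sub>m m)"
  let ?L = "four_block_mat (1\<^sub>m n) (0\<^sub>m n m) (- B) (x \<cdot>\<^sub>m 1\<^sub>m m)"
  have M: "?M \<in> carrier_mat (n + m) (n + m)" and R: "?R \<in> carrier_mat (n + m) (n + m)"
    and L: "?L \<in> carrier_mat (n + m) (n + m)"
    and AB: "x \<cdot>\<^sub>m 1\<^sub>m n - A * B \<in> carrier_mat n n"
    and BA: "x \<cdot>\<^sub>m 1\<^sub>m m - B * A \<in> carrier_mat m m" using A B by auto
  have "?M * ?R = four_block_mat (x \<cdot>\<^sub>m 1\<^sub>m n * 1\<^sub>m n + A * (- B)) (x \<cdot>\<^sub>m 1\<^sub>m n * 0\<^sub>m n m + A * 1\<^sub>m m)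
      (B * 1\<^sub>m n + 1\<^sub>m m * (- B)) (B * 0\<^sub>m n m + 1\<^sub>m m * 1\<^sub>m m)"
    using A B by (intro mult_four_block_mat) auto
  also have "\<dots> = four_block_mat (x \<cdot>\<^sub>m 1\<^sub>m n - A * B) A (0\<^sub>m m n) (1\<^sub>m m)"
    using A B by (intro cong_four_block_mat) (auto simp: add_uminus_minus_mat)
  finally have "det (?M * ?R) = det (x \<cdot>\<^sub>m 1\<^sub>m n - A * B)"
    using A B AB by (simp add: det_four_block_mat_lower_left_zero[of _ n _ m])
  moreover have "det ?R = 1"
    using A B by (simp add: det_four_block_mat_upper_right_zero[of _ n _ m])
  ultimately have 1: "det ?M = det (x \<cdot>\<^sub>m 1\<^sub>m n - A * B)"
    using det_mult[OF M R] by simp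
  have "?L * ?M = four_block_mat (1\<^sub>m n * (x \<cdot>\<^sub>m 1\<^sub>m n) + 0\<^sub>m n m * B) (1\<^sub>m n * A + 0\<^sub>m n m * 1\<^sub>m m)
      (- B * (x \<cdot>\<^sub>m 1\<^sub>m n) + x \<cdot>\<^sub>m 1\<^sub>m m * B) (- B * A + x \<cdot>\<^sub>m 1\<^sub>m m * 1\<^sub>m m)"
    using A B by (intro mult_four_block_mat) auto
  also have "\<dots> = four_block_mat (x \<cdot>\<^sub>m 1\<^sub>m n) A (0\<^sub>m m n) (x \<cdot>\<^sub>m 1\<^sub>m m - B * A)"
  proof (intro cong_four_block_mat)
    have "- B * (x \<cdot>\<^sub>m 1\<^sub>m n) = - (x \<cdot>\<^sub>m B)"
      using B by (subst mult_smult_distrib[of _ m n _ n]) (auto intro: eq_matI)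
    moreover have "x \<cdot>\<^sub>m 1\<^sub>m m * B = x \<cdot>\<^sub>m B"
      using B by (subst mult_smult_assoc_mat[of _ m m _ n]) auto
    ultimately show "- B * (x \<cdot>\<^sub>m 1\<^sub>m n) + x \<cdot>\<^sub>m 1\<^sub>m m * B = 0\<^sub>m m n"
      using B by (auto intro: eq_matI)
    show "- B * A + x \<cdot>\<^sub>m 1\<^sub>m m * 1\<^sub>m m = x \<cdot>\<^sub>m 1\<^sub>m m - B * A"
      using A B by (auto intro!: eq_matI)
  qed (use A B in auto)
  finally have "det (?L * ?M) = x ^ n * det (x \<cdot>\<^sub>m 1\<^sub>m m - B * A)"
    using A B BA by (simp add: det_four_block_mat_lower_left_zero[of _ n _ m])
  moreover have "det ?L = x ^ m"
    using A B by (simp add: det_four_block_mat_upper_right_zero[of _ n _ m])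
  ultimately show ?thesis
    using det_mult[OF L M] 1 by simp
qed

text \<open>At each x this is the determinant identity above, and in characteristic 0 a polynomial
  is determined by its values. The powers of X account for the different sizes n and m.\<close>

lemma char_poly_mult_commute:
  fixes A B :: "'a :: field_char_0 mat"
  assumes A: "A \<in> carrier_mat n m" and B: "B \<in> carrier_mat m n"
  shows "[:0, 1:] ^ m * char_poly (A * B) = [:0, 1:] ^ n * char_poly (B * A)"
proof -
  have "poly ([:0, 1:] ^ m * char_poly (A * B)) x = poly ([:0, 1:] ^ n * char_poly (B * A)) x" for x
    using det_smult_one_minus_mult_commute[OF A B, of x]
    by (simp add: poly_char_poly[OF mult_carrier_mat[OF A B]] poly_char_poly[OF mult_carrier_mat[OF B A]])
  then show ?thesis by (simp add: poly_eq_poly_eq_iff[symmetric] fun_eq_iff)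
qed

lemma char_poly_add_smult_one:
  fixes A :: "'a :: field_char_0 mat"
  assumes A: "A \<in> carrier_mat n n"
  shows "char_poly (A + c \<cdot>\<^sub>m 1\<^sub>m n) = char_poly A \<circ>\<^sub>p [:- c, 1:]"
proof -
  have "poly (char_poly (A + c \<cdot>\<^sub>m 1\<^sub>m n)) x = poly (char_poly A \<circ>\<^sub>p [:- c, 1:]) x" for x
  proof -
    have "x \<cdot>\<^sub>m 1\<^sub>m n - (A + c \<cdot>\<^sub>m 1\<^sub>m n) = (x - c) \<cdot>\<^sub>m 1\<^sub>m n - A"
      using A by (auto intro!: eq_matI)
    then show ?thesis
      using A by (simp add: poly_char_poly[of _ n] poly_pcompose)
  qed
  then show ?thesis by (simp add: poly_eq_poly_eq_iff[symmetric] fun_eq_iff)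
qed

text \<open>Scalar blocks commute with all others, so at x the block determinant collapses to that
  of (x - c)^2 I - C D.\<close>

lemma char_poly_four_block_scalar_diagonal:
  fixes C D :: "'a :: field_char_0 mat"
  assumes C: "C \<in> carrier_mat n n" and D: "D \<in> carrier_mat n n"
  shows "char_poly (four_block_mat (c \<cdot>\<^sub>m 1\<^sub>m n) C D (c \<cdot>\<^sub>m 1\<^sub>m n)) = char_poly (C * D) \<circ>\<^sub>p ([:- c, 1:] ^ 2)"
    (is "char_poly ?M = _")
proof -
  have M: "?M \<in> carrier_mat (n + n) (n + n)" using C D by simp
  have "poly (char_poly ?M) x = poly (char_poly (C * D) \<circ>\<^sub>p ([:- c, 1:] ^ 2)) x" for x
  proof -
    let ?S = "(x - c) \<cdot>\<^sub>m 1\<^sub>m n"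
    have S: "?S * A = (x - c) \<cdot>\<^sub>m A" "A * ?S = (x - c) \<cdot>\<^sub>m A" if "A \<in> carrier_mat n n" for A
      using that by (auto simp: mult_smult_distrib[of _ n n _ n] mult_smult_assoc_mat[of _ n n _ n])
    have "x \<cdot>\<^sub>m 1\<^sub>m (n + n) - ?M = four_block_mat ?S (- C) (- D) ?S"
      using C D by (auto intro!: eq_matI)
    then have "poly (char_poly ?M) x = det (four_block_mat ?S (- C) (- D) ?S)"
      using poly_char_poly[OF M, of x] by simp
    also have "\<dots> = det (?S * ?S - (- C) * (- D))"
      using C D by (intro det_four_block_mat) (auto simp: S)
    also have "?S * ?S - (- C) * (- D) = ((x - c) ^ 2) \<cdot>\<^sub>m 1\<^sub>m n - C * D"
      using C D by (auto intro!: eq_matI simp: S power2_eq_square)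
    also have "det \<dots> = poly (char_poly (C * D) \<circ>\<^sub>p ([:- c, 1:] ^ 2)) x"
      using C D by (simp add: poly_char_poly[of _ n] poly_pcompose)
    finally show ?thesis .
  qed
  then show ?thesis by (simp add: poly_eq_poly_eq_iff[symmetric] fun_eq_iff)
qed

lemma proots_linear_power: "proots ([:- a, 1:] ^ m) = replicate_mset m (a :: 'a :: idom)"
  by (simp add: proots_power repeat_mset_replicate_mset)

section \<open>Matrices indexed by lists\<close>

lemma length_enumerates: "enumerates vs V \<Longrightarrow> length vs = card V"
  using distinct_card[of vs] by (auto simp: enumerates_def)

text \<open>Indexing by list elements turns a product of matrices into a sum over the underlying
  set, so matrix identities reduce to counting sets or edges.\<close>

definition kernel_mat :: "'a list \<Rightarrow> 'b list \<Rightarrow> ('a \<Rightarrow> 'b \<Rightarrow> 'c) \<Rightarrow> 'c mat" where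
  "kernel_mat xs ys f = mat (length xs) (length ys) (\<lambda>(i, j). f (xs ! i) (ys ! j))"

lemma kernel_mat_carrier [simp]: "kernel_mat xs ys f \<in> carrier_mat (length xs) (length ys)"
  by (simp add: kernel_mat_def)

lemma kernel_mat_cong:
  assumes "\<And>x y. x \<in> set xs \<Longrightarrow> y \<in> set ys \<Longrightarrow> f x y = g x y"
  shows "kernel_mat xs ys f = kernel_mat xs ys g"
  using assms by (auto simp: kernel_mat_def intro!: eq_matI)

lemma kernel_mat_transpose: "transpose_mat (kernel_mat xs ys f) = kernel_mat ys xs (\<lambda>y x. f x y)"
  unfolding kernel_mat_def by (rule eq_matI) auto

lemma kernel_mat_mult:
  fixes f :: "'a \<Rightarrow> 'b \<Rightarrow> 'd :: comm_semiring_0"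
  assumes "enumerates ys Y"
  shows "kernel_mat xs ys f * kernel_mat ys zs g = kernel_mat xs zs (\<lambda>x z. \<Sum>y\<in>Y. f x y * g y z)"
  unfolding kernel_mat_def
  by (rule eq_matI) (auto simp: scalar_prod_def sum_enumerates[OF assms, symmetric])

lemma kernel_mat_add:
  "kernel_mat xs ys f + kernel_mat xs ys g = kernel_mat xs ys (\<lambda>x y. f x y + g x y)"
  unfolding kernel_mat_def by (rule eq_matI) auto

lemma kernel_mat_scalar:
  fixes c :: "'b :: semiring_1"
  assumes "distinct xs"
  shows "c \<cdot>\<^sub>m 1\<^sub>m (length xs) = kernel_mat xs xs (\<lambda>x y. if x = y then c else 0)"
  unfolding kernel_mat_def
  by (rule eq_matI) (auto simp: nth_eq_iff_index_eq[OF assms])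

lemma kernel_mat_append:
  "kernel_mat (xs @ ys) (xs @ ys) f = four_block_mat (kernel_mat xs xs f) (kernel_mat xs ys f)
    (kernel_mat ys xs f) (kernel_mat ys ys f)"
  unfolding kernel_mat_def by (rule eq_matI) (auto simp: nth_append)

section \<open>Inclusion matrices between consecutive layers\<close>

definition layer :: "nat \<Rightarrow> nat \<Rightarrow> nat set set" where
  "layer n i = {S. S \<subseteq> {1..n} \<and> card S = i}"

definition incl :: "'a set \<Rightarrow> 'a set \<Rightarrow> complex" where
  "incl S T = (if S \<subseteq> T then 1 else 0)"

lemma finite_layer [simp]: "finite (layer n i)"
  by (rule finite_subset[of _ "Pow {1..n}"]) (auto simp: layer_def)

lemma card_layer: "card (layer n i) = n choose i"
  using n_subsets[of "{1..n}" i] by (simp add: layer_def)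

lemma finite_in_layer: "S \<in> layer n i \<Longrightarrow> finite S"
  by (auto simp: layer_def intro: finite_subset)

section \<open>Neighbours of sets in the layers directly above and below\<close>

lemma upper_neighbours:
  assumes S: "S \<in> layer n i"
  shows "{W \<in> layer n (Suc i). S \<subseteq> W} = (\<lambda>x. insert x S) ` ({1..n} - S)"
proof (intro equalityI subsetI)
  fix W assume "W \<in> {W \<in> layer n (Suc i). S \<subseteq> W}"
  then have W: "W \<subseteq> {1..n}" "card W = Suc i" "S \<subseteq> W" by (auto simp: layer_def)
  have "card (W - S) = 1"
    using W S card_Diff_subset[of S W] finite_in_layer[OF S] by (simp add: layer_def)
  then obtain x where "W - S = {x}" by (rule card_1_singletonE)
  then have "W = insert x S" "x \<in> {1..n} - S" using W by auto
  then show "W \<in> (\<lambda>x. insert x S) ` ({1..n} - S)" by blast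
qed (use S finite_in_layer[OF S] in \<open>auto simp: layer_def\<close>)

lemma lower_neighbours:
  assumes S: "S \<in> layer n (Suc i)"
  shows "{V \<in> layer n i. V \<subseteq> S} = (\<lambda>x. S - {x}) ` S"
proof (intro equalityI subsetI)
  fix V assume "V \<in> {V \<in> layer n i. V \<subseteq> S}"
  then have V: "V \<subseteq> {1..n}" "card V = i" "V \<subseteq> S" "finite V"
    by (auto simp: layer_def intro: finite_subset)
  have "card (S - V) = 1"
    using V S card_Diff_subset[of V S] by (simp add: layer_def)
  then obtain x where "S - V = {x}" by (rule card_1_singletonE)
  then have "V = S - {x}" "x \<in> S" using V by auto
  then show "V \<in> (\<lambda>x. S - {x}) ` S" by blast
qed (use S finite_in_layer[OF S] in \<open>auto simp: layer_def\<close>)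

lemma card_upper_neighbours:
  assumes S: "S \<in> layer n i"
  shows "card {W \<in> layer n (Suc i). S \<subseteq> W} = n - i"
proof -
  have "card ((\<lambda>x. insert x S) ` ({1..n} - S)) = card ({1..n} - S)"
    by (rule card_image) (auto simp: inj_on_def)
  also have "\<dots> = n - i"
    using S card_Diff_subset[of S "{1..n}"] finite_in_layer[OF S] by (auto simp: layer_def)
  finally show ?thesis by (simp add: upper_neighbours[OF S])
qed

lemma card_lower_neighbours:
  assumes S: "S \<in> layer n (Suc i)"
  shows "card {V \<in> layer n i. V \<subseteq> S} = Suc i"
proof -
  have "card ((\<lambda>x. S - {x}) ` S) = card S"
    by (rule card_image) (auto simp: inj_on_def)
  also have "\<dots> = Suc i" using S by (simp add: layer_def)
  finally show ?thesis by (simp only: lower_neighbours[OF S])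
qed

text \<open>The union of two distinct i-sets has at least i + 1 elements, so an (i + 1)-set
  containing both must equal it.\<close>

lemma common_upper_neighbours:
  assumes S: "S \<in> layer n i" and T: "T \<in> layer n i" and neq: "S \<noteq> T"
  shows "{W \<in> layer n (Suc i). S \<subseteq> W \<and> T \<subseteq> W} = (if card (S \<union> T) = Suc i then {S \<union> T} else {})"
proof -
  have fin: "finite S" "finite T" using finite_in_layer[OF S] finite_in_layer[OF T] by simp_all
  have cards: "card S = i" "card T = i" "S \<union> T \<subseteq> {1..n}" using S T by (auto simp: layer_def)
  have "\<not> T \<subseteq> S" using neq cards card_subset_eq[OF fin(1), of T] by metis
  then have "S \<subset> S \<union> T" by blast
  then have gt: "Suc i \<le> card (S \<union> T)"
    using psubset_card_mono[of "S \<union> T" S] fin cards by simp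
  have uniq: "S \<union> T = W" if "W \<in> layer n (Suc i)" "S \<subseteq> W" "T \<subseteq> W" for W
  proof (rule card_seteq[OF finite_in_layer[OF that(1)]])
    show "card W \<le> card (S \<union> T)" using gt that(1) by (simp add: layer_def)
  qed (use that in blast)
  have mem: "S \<union> T \<in> layer n (Suc i) \<longleftrightarrow> card (S \<union> T) = Suc i"
    using cards by (simp add: layer_def)
  show ?thesis
  proof (cases "card (S \<union> T) = Suc i")
    case True
    show ?thesis unfolding if_P[OF True] using uniq mem True by blast
  next
    case False
    show ?thesis unfolding if_not_P[OF False] using uniq mem False by blast
  qed
qed

text \<open>Dual argument: the intersection of two distinct (i + 1)-sets has at most i
  elements.\<close>

lemma common_lower_neighbours:
  assumes S: "S \<in> layer n (Suc i)" and T: "T \<in> layer n (Suc i)" and neq: "S \<noteq> T"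
  shows "{V \<in> layer n i. V \<subseteq> S \<and> V \<subseteq> T} = (if card (S \<inter> T) = i then {S \<inter> T} else {})"
proof -
  have fin: "finite S" "finite T" using finite_in_layer[OF S] finite_in_layer[OF T] by simp_all
  have cards: "card S = Suc i" "card T = Suc i" "S \<inter> T \<subseteq> {1..n}" using S T by (auto simp: layer_def)
  have "\<not> S \<subseteq> T" using neq cards card_subset_eq[OF fin(2), of S] by metis
  then have "S \<inter> T \<subset> S" by blast
  then have lt: "card (S \<inter> T) \<le> i"
    using psubset_card_mono[of S "S \<inter> T"] fin cards by simp
  have uniq: "V = S \<inter> T" if "V \<in> layer n i" "V \<subseteq> S" "V \<subseteq> T" for V
  proof (rule card_seteq)
    show "card (S \<inter> T) \<le> card V" using lt that(1) by (simp add: layer_def)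
  qed (use that fin in auto)
  have mem: "S \<inter> T \<in> layer n i \<longleftrightarrow> card (S \<inter> T) = i"
    using cards by (simp add: layer_def)
  show ?thesis
  proof (cases "card (S \<inter> T) = i")
    case True
    show ?thesis unfolding if_P[OF True] using uniq mem True by blast
  next
    case False
    show ?thesis unfolding if_not_P[OF False] using uniq mem False by blast
  qed
qed

lemma sum_incl_upper:
  "(\<Sum>W\<in>layer n j. incl S W * incl T W) = of_nat (card {W \<in> layer n j. S \<subseteq> W \<and> T \<subseteq> W})"
proof -
  have "(\<Sum>W\<in>layer n j. incl S W * incl T W) = (\<Sum>W\<in>layer n j. if S \<subseteq> W \<and> T \<subseteq> W then 1 else 0)"
    by (rule sum.cong) (auto simp: incl_def)
  also have "\<dots> = of_nat (card {W \<in> layer n j. S \<subseteq> W \<and> T \<subseteq> W})"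
    by (simp flip: sum.inter_filter)
  finally show ?thesis .
qed

lemma sum_incl_lower:
  "(\<Sum>V\<in>layer n j. incl V S * incl V T) = of_nat (card {V \<in> layer n j. V \<subseteq> S \<and> V \<subseteq> T})"
proof -
  have "(\<Sum>V\<in>layer n j. incl V S * incl V T) = (\<Sum>V\<in>layer n j. if V \<subseteq> S \<and> V \<subseteq> T then 1 else 0)"
    by (rule sum.cong) (auto simp: incl_def)
  also have "\<dots> = of_nat (card {V \<in> layer n j. V \<subseteq> S \<and> V \<subseteq> T})"
    by (simp flip: sum.inter_filter)
  finally show ?thesis .
qed

text \<open>This is the commutation relation of the inclusion matrices, entry by entry. On the
  diagonal it compares the degrees n - (i + 1) and i + 1. Off the diagonal both counts are 0 or 1,
  and they agree because the sizes of union and intersection add up to 2(i + 1).\<close>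

lemma sum_incl_commutation:
  assumes S: "S \<in> layer n (Suc i)" and T: "T \<in> layer n (Suc i)"
  shows "(\<Sum>W\<in>layer n (Suc (Suc i)). incl S W * incl T W) =
    (\<Sum>V\<in>layer n i. incl V S * incl V T) + (if S = T then of_nat n - 2 * of_nat (Suc i) else 0)"
proof (cases "S = T")
  case True
  \<comment> \<open>Ensures that the upper degree, a truncated difference of naturals, is the true
    difference in the complex numbers.\<close>
  have "Suc i \<le> n" using S card_mono[of "{1..n}" S] by (auto simp: layer_def)
  then show ?thesis
    using True card_upper_neighbours[OF S] card_lower_neighbours[OF S]
    by (simp add: sum_incl_upper sum_incl_lower of_nat_diff)
next
  case False
  have "card (S \<union> T) + card (S \<inter> T) = 2 * Suc i"
    using card_Un_Int[OF finite_in_layer[OF S] finite_in_layer[OF T]] S T by (simp add: layer_def)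
  then have "card (S \<union> T) = Suc (Suc i) \<longleftrightarrow> card (S \<inter> T) = i" by arith
  then show ?thesis
    using False by (simp add: sum_incl_upper sum_incl_lower common_upper_neighbours[OF S T]
        common_lower_neighbours[OF S T])
qed

definition inclusion_mat :: "'a set list \<Rightarrow> 'a set list \<Rightarrow> complex mat" where
  "inclusion_mat xs ys = kernel_mat xs ys incl"

text \<open>For 2j at most n the subtraction does not truncate, and the number is the growth in size
  from layer j - 1 to layer j.\<close>

definition binom_diff :: "nat \<Rightarrow> nat \<Rightarrow> nat" where
  "binom_diff n j = binom n (int j) - binom n (int j - 1)"

lemma binom_diff_0: "binom_diff n 0 = 1"
  by (simp add: binom_diff_def binom_def)

lemma binom_diff_Suc: "binom_diff n (Suc j) = (n choose Suc j) - (n choose j)"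
  by (simp add: binom_diff_def binom_def nat_add_distrib)

text \<open>The fixed family \<open>E\<close> makes consecutive inclusion matrices use the same
  enumeration of their common layer. The bound on i keeps the induction in the lower half of the
  lattice, where the layers grow.\<close>

lemma char_poly_inclusion_mat:
  assumes E: "\<And>i. enumerates (E i) (layer n i)" and i: "2 * i \<le> n"
  shows "char_poly (inclusion_mat (E i) (E (Suc i)) * transpose_mat (inclusion_mat (E i) (E (Suc i)))) =
    (\<Prod>j\<le>i. [:- ((of_nat i - of_nat j + 1) * (of_nat n - of_nat i - of_nat j)), 1:] ^ binom_diff n j)"
  using i
proof (induction i)
  \<comment> \<open>Layer 0 contains only the empty set, so the matrix is 1 by 1 and its entry is
    the number n of singletons.\<close>
  case 0
  have "card (layer n 0) = 1" by (simp add: card_layer)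
  then have len: "length (E 0) = 1" using length_enumerates[OF E] by simp
  have E0: "E 0 ! 0 \<in> layer n 0"
    using E[of 0] len nth_mem[of 0 "E 0"] by (auto simp: enumerates_def)
  define M where "M = inclusion_mat (E 0) (E (Suc 0)) * transpose_mat (inclusion_mat (E 0) (E (Suc 0)))"
  have M: "M = kernel_mat (E 0) (E 0) (\<lambda>S T. \<Sum>W\<in>layer n (Suc 0). incl S W * incl T W)"
    unfolding M_def inclusion_mat_def kernel_mat_transpose kernel_mat_mult[OF E] ..
  have c: "M \<in> carrier_mat 1 1" unfolding M using kernel_mat_carrier[of "E 0" "E 0"] len by metis
  have "M $$ (0, 0) = of_nat n"
    unfolding M using card_upper_neighbours[OF E0] len
    by (simp add: kernel_mat_def sum_incl_upper)
  then have "diag_mat M = [of_nat n]" using c by (simp add: diag_mat_def)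
  moreover have "upper_triangular M" using c by (auto simp: upper_triangular_def)
  ultimately have "char_poly M = [:- of_nat n, 1:]"
    using char_poly_upper_triangular[OF c] by simp
  then show ?case by (simp add: binom_diff_0 M_def)
next
  case (Suc i)
  let ?U = "\<lambda>i. inclusion_mat (E i) (E (Suc i))"
  let ?D = "\<lambda>i. transpose_mat (?U i)"
  let ?c = "of_nat n - 2 * of_nat (Suc i) :: complex"
  let ?X = "[:0, 1:] :: complex poly"
  have len: "length (E j) = n choose j" for j
    using length_enumerates[OF E] by (simp add: card_layer)
  have U: "?U j \<in> carrier_mat (n choose j) (n choose Suc j)" for j
    unfolding inclusion_mat_def using kernel_mat_carrier[of "E j" "E (Suc j)"] by (simp add: len)
  have D: "?D j \<in> carrier_mat (n choose Suc j) (n choose j)" for j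
    using U by simp
  have "?U (Suc i) * ?D (Suc i) = kernel_mat (E (Suc i)) (E (Suc i))
      (\<lambda>S T. (\<Sum>V\<in>layer n i. incl V S * incl V T) + (if S = T then ?c else 0))"
    unfolding inclusion_mat_def kernel_mat_transpose kernel_mat_mult[OF E]
    by (rule kernel_mat_cong, rule sum_incl_commutation)
      (use E[of "Suc i"] in \<open>auto simp: enumerates_def\<close>)
  also have "\<dots> = ?D i * ?U i + ?c \<cdot>\<^sub>m 1\<^sub>m (n choose Suc i)"
    unfolding inclusion_mat_def kernel_mat_transpose kernel_mat_mult[OF E] len[symmetric]
    using E[of "Suc i"] by (subst kernel_mat_scalar) (auto simp: enumerates_def kernel_mat_add)
  finally have step: "char_poly (?U (Suc i) * ?D (Suc i)) = char_poly (?D i * ?U i) \<circ>\<^sub>p [:- ?c, 1:]"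
    using char_poly_add_smult_one[OF mult_carrier_mat[OF D U, of i], of ?c] by simp
  \<comment> \<open>\<open>?D i * ?U i\<close> is the larger of the two products. Its surplus in
    size becomes the multiplicity of an additional root 0, once the common power of X is
    cancelled.\<close>
  have "n choose i \<le> n choose Suc i" using Suc.prems by (intro binomial_mono) auto
  then have "?X ^ (n choose Suc i) = ?X ^ (n choose i) * ?X ^ binom_diff n (Suc i)"
    by (simp add: binom_diff_Suc flip: power_add)
  then have "?X ^ (n choose i) * char_poly (?D i * ?U i) =
      ?X ^ (n choose i) * (?X ^ binom_diff n (Suc i) * char_poly (?U i * ?D i))"
    using char_poly_mult_commute[OF D U, of i] by (simp add: mult.assoc)
  then have "char_poly (?D i * ?U i) = ?X ^ binom_diff n (Suc i) * char_poly (?U i * ?D i)"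
    by (simp only: mult_cancel_left) simp
  also have "char_poly (?U i * ?D i) = (\<Prod>j\<le>i. [:- ((of_nat i - of_nat j + 1) *
      (of_nat n - of_nat i - of_nat j)), 1:] ^ binom_diff n j)"
    using Suc by simp
  finally have DU: "char_poly (?D i * ?U i) = ?X ^ binom_diff n (Suc i) *
      (\<Prod>j\<le>i. [:- ((of_nat i - of_nat j + 1) * (of_nat n - of_nat i - of_nat j)), 1:] ^ binom_diff n j)" .
  have shift: "[:- a, 1:] ^ m \<circ>\<^sub>p [:- ?c, 1:] = [:- (a + ?c), 1:] ^ m" for a m
    by (simp add: pcompose_hom.hom_power pcompose_pCons)
  \<comment> \<open>Passing to i + 1 raises the first factor by one and lowers the second by one;
    the product changes by n - 2(i + 1), whatever j is.\<close>
  have root: "(of_nat i - of_nat j + 1) * (of_nat n - of_nat i - of_nat j) + ?c =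
      (of_nat (Suc i) - of_nat j + 1) * (of_nat n - of_nat (Suc i) - of_nat j)" for j
    by (simp add: algebra_simps)
  \<comment> \<open>The additional root 0 is shifted to n - 2(i + 1), which is the formula for the
    new index j = i + 1.\<close>
  have new: "[:0, 1:] ^ m \<circ>\<^sub>p [:- ?c, 1:] = [:- ((of_nat (Suc i) - of_nat (Suc i) + 1) *
      (of_nat n - of_nat (Suc i) - of_nat (Suc i))), 1:] ^ m" for m
    using shift[of 0 m] by (simp add: algebra_simps)
  have "char_poly (?U (Suc i) * ?D (Suc i)) =
      (\<Prod>j\<le>i. [:- ((of_nat (Suc i) - of_nat j + 1) * (of_nat n - of_nat (Suc i) - of_nat j)), 1:]
        ^ binom_diff n j) * ([:- ((of_nat (Suc i) - of_nat (Suc i) + 1) *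
      (of_nat n - of_nat (Suc i) - of_nat (Suc i))), 1:] ^ binom_diff n (Suc i))"
    unfolding step DU pcompose_mult pcompose_prod shift root new by (rule mult.commute)
  also have "\<dots> = (\<Prod>j\<le>Suc i. [:- ((of_nat (Suc i) - of_nat j + 1) *
      (of_nat n - of_nat (Suc i) - of_nat j)), 1:] ^ binom_diff n j)"
    by (rule prod.atMost_Suc[symmetric])
  finally show ?case .
qed

section \<open>Line graphs and incidence matrices\<close>

definition incidence :: "'a \<Rightarrow> 'a set \<Rightarrow> complex" where
  "incidence v e = (if v \<in> e then 1 else 0)"

lemma sum_incidence_vertices:
  assumes "finite V" "e \<subseteq> V"
  shows "(\<Sum>v\<in>V. incidence v e * incidence v f) = of_nat (card (e \<inter> f))"
proof -
  have "(\<Sum>v\<in>V. incidence v e * incidence v f) = (\<Sum>v\<in>V. if v \<in> e \<inter> f then 1 else 0)"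
    by (rule sum.cong) (auto simp: incidence_def)
  also have "\<dots> = of_nat (card {v \<in> V. v \<in> e \<inter> f})"
    using assms(1) by (simp flip: sum.inter_filter)
  also have "{v \<in> V. v \<in> e \<inter> f} = e \<inter> f" using assms(2) by blast
  finally show ?thesis .
qed

lemma sum_incidence_edges:
  assumes "finite F"
  shows "(\<Sum>e\<in>F. incidence u e * incidence v e) = of_nat (card {e \<in> F. u \<in> e \<and> v \<in> e})"
proof -
  have "(\<Sum>e\<in>F. incidence u e * incidence v e) = (\<Sum>e\<in>F. if u \<in> e \<and> v \<in> e then 1 else 0)"
    by (rule sum.cong) (auto simp: incidence_def)
  also have "\<dots> = of_nat (card {e \<in> F. u \<in> e \<and> v \<in> e})"
    using assms by (simp flip: sum.inter_filter)
  finally show ?thesis .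
qed

text \<open>The (e, f) entry of the product is the size of the intersection of e and f: 2 on the
  diagonal, and otherwise at most 1, since distinct two-element sets share at most one
  point.\<close>

lemma adjacency_matrix_line_graph:
  assumes G: "edges G = F" and fs: "enumerates fs F" and vs: "enumerates vs V"
    and F: "\<And>e. e \<in> F \<Longrightarrow> e \<subseteq> V \<and> card e = 2"
  shows "adjacency_matrix (line_graph G) fs =
    transpose_mat (kernel_mat vs fs incidence) * kernel_mat vs fs incidence + (- 2) \<cdot>\<^sub>m 1\<^sub>m (length fs)"
proof -
  have finV: "finite V" using vs by (auto simp: enumerates_def)
  have dist: "distinct fs" and set: "set fs = F" using fs by (auto simp: enumerates_def)
  have entry: "(if adjacent (line_graph G) e f then 1 else 0) =
      (\<Sum>v\<in>V. incidence v e * incidence v f) + (if e = f then - 2 else 0)"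
    if e: "e \<in> set fs" and f: "f \<in> set fs" for e f
  proof -
    have eF: "e \<in> F" "e \<subseteq> V" "card e = 2" and fF: "f \<in> F" "f \<subseteq> V" "card f = 2"
      using F e f set by auto
    have fin: "finite e" "finite f" using finite_subset[OF _ finV] eF fF by auto
    have adj: "adjacent (line_graph G) e f \<longleftrightarrow> e \<noteq> f \<and> e \<inter> f \<noteq> {}"
    proof -
      have "adjacent (line_graph G) e f \<longleftrightarrow>
          (\<exists>e' f'. {e, f} = {e', f'} \<and> e' \<in> F \<and> f' \<in> F \<and> e' \<noteq> f' \<and> e' \<inter> f' \<noteq> {})"
        using G by (simp add: adjacent_def line_graph_def edges_def)
      then show ?thesis using eF(1) fF(1) unfolding doubleton_eq_iff by blast
    qed
    have "card (e \<inter> f) = 1" if "e \<noteq> f" "e \<inter> f \<noteq> {}"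
    proof -
      have "\<not> e \<subseteq> f" using card_subset_eq[OF fin(2), of e] eF fF that(1) by auto
      then have "card (e \<inter> f) < card e" using fin by (intro psubset_card_mono) auto
      moreover have "card (e \<inter> f) \<noteq> 0" using that(2) fin by simp
      ultimately show ?thesis using eF by linarith
    qed
    then show ?thesis
      using adj eF by (auto simp: sum_incidence_vertices[OF finV eF(2)])
  qed
  have "adjacency_matrix (line_graph G) fs =
      kernel_mat fs fs (\<lambda>e f. if adjacent (line_graph G) e f then 1 else 0)"
    by (simp add: adjacency_matrix_def kernel_mat_def)
  also have "\<dots> = kernel_mat fs fs (\<lambda>e f. (\<Sum>v\<in>V. incidence v e * incidence v f) + (if e = f then - 2 else 0))"
    by (rule kernel_mat_cong) (rule entry)
  finally show ?thesis
    unfolding kernel_mat_transpose kernel_mat_mult[OF vs] kernel_mat_scalar[OF dist] kernel_mat_add .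
qed

section \<open>The two middle layers\<close>

text \<open>The edges with lower and upper endpoint told apart. They stay unordered pairs because
  they serve as the vertices of the line graph.\<close>

definition flags :: "nat \<Rightarrow> nat \<Rightarrow> nat set set set" where
  "flags n i = {{U, W} | U W. U \<in> layer n i \<and> W \<in> layer n (Suc i) \<and> U \<subseteq> W}"

lemma layer_disjoint: "layer n i \<inter> layer n (Suc i) = {}"
  by (auto simp: layer_def)

section \<open>Edges of the graph on two consecutive layers\<close>

lemma mem_edges_boolean_layers:
  "e \<in> edges (boolean_layers n a b) \<longleftrightarrow>
    (\<exists>U W. e = {U, W} \<and> U \<subseteq> {1..n} \<and> W \<subseteq> {1..n} \<and> card (sym_diff U W) = 1 \<and>
      (card U = a \<or> card U = b) \<and> (card W = a \<or> card W = b))"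
    (is "?L \<longleftrightarrow> ?R")
proof
  let ?S = "{U. U \<subseteq> {1..n} \<and> (card U = a \<or> card U = b)}"
  let ?P = "\<lambda>U W. U \<subseteq> {1..n} \<and> W \<subseteq> {1..n} \<and> card (sym_diff U W) = 1"
  have L: "?L \<longleftrightarrow> (\<exists>U W. e = {U, W} \<and> ?P U W) \<and> e \<subseteq> ?S"
    unfolding boolean_layers_def induced_subgraph_def boolean_lattice_def edges_def snd_conv
      mem_Collect_eq ..
  show ?R if l: ?L
  proof -
    obtain U W where e: "e = {U, W}" and P: "?P U W"
      using l unfolding L by (elim exE conjE) (rule that, assumption, intro conjI)
    have "e \<subseteq> ?S" using l unfolding L by (rule conjunct2)
    then have "(card U = a \<or> card U = b) \<and> (card W = a \<or> card W = b)" unfolding e by simp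
    then show ?thesis using e P by (intro exI[of _ U] exI[of _ W]) simp
  qed
  show ?L if r: ?R
  proof -
    obtain U W where UW: "e = {U, W}" "?P U W" "card U = a \<or> card U = b" "card W = a \<or> card W = b"
      using r by (elim exE conjE) (rule that, assumption, intro conjI)
    have "e \<subseteq> ?S" using UW by simp
    moreover have "\<exists>U W. e = {U, W} \<and> ?P U W" using UW(1,2) by (intro exI[of _ U] exI[of _ W] conjI) simp_all
    ultimately show ?thesis unfolding L by (intro conjI)
  qed
qed

text \<open>The single element of the symmetric difference lies in exactly one of the sets, which is
  the other one with that element inserted.\<close>

lemma card_sym_diff_eq_1:
  assumes "card (sym_diff U W) = 1" "finite U" "finite W"
  shows "U \<subseteq> W \<and> card W = Suc (card U) \<or> W \<subseteq> U \<and> card U = Suc (card W)"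
proof -
  obtain x where x: "sym_diff U W = {x}" using assms(1) by (rule card_1_singletonE)
  have iff: "y \<in> U \<and> y \<notin> W \<or> y \<in> W \<and> y \<notin> U \<longleftrightarrow> y = x" for y
    using Set.set_eq_iff[THEN iffD1, OF x, rule_format, of y] by simp
  show ?thesis
  proof (cases "x \<in> U")
    case True
    have "U = insert x W"
    proof (rule Set.set_eqI)
      show "y \<in> U \<longleftrightarrow> y \<in> insert x W" for y using iff[of y] iff[of x] True by (cases "y = x") auto
    qed
    moreover have "x \<notin> W" using iff[of x] True by simp
    ultimately have "card U = Suc (card W)" "W \<subseteq> U"
      using card_insert_disjoint[OF assms(3)] by auto
    then show ?thesis by simp
  next
    case False
    have "W = insert x U"
    proof (rule Set.set_eqI)
      show "y \<in> W \<longleftrightarrow> y \<in> insert x U" for y using iff[of y] iff[of x] False by (cases "y = x") auto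
    qed
    then have "card W = Suc (card U)" "U \<subseteq> W"
      using card_insert_disjoint[OF assms(2) False] by auto
    then show ?thesis by simp
  qed
qed

lemma edges_boolean_layers: "edges (boolean_layers n i (Suc i)) = flags n i"
proof (intro equalityI subsetI)
  fix e assume "e \<in> edges (boolean_layers n i (Suc i))"
  then obtain U W where e: "e = {U, W}" and sub: "U \<subseteq> {1..n}" "W \<subseteq> {1..n}"
    and one: "card (sym_diff U W) = 1"
    and cards: "card U = i \<or> card U = Suc i" "card W = i \<or> card W = Suc i"
    unfolding mem_edges_boolean_layers by blast
  have fin: "finite U" "finite W" using finite_subset[OF sub(1)] finite_subset[OF sub(2)] by simp_all
  from card_sym_diff_eq_1[OF one fin] show "e \<in> flags n i"
  proof
    assume "U \<subseteq> W \<and> card W = Suc (card U)"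
    then have "U \<in> layer n i" "W \<in> layer n (Suc i)" "U \<subseteq> W" using cards sub by (auto simp: layer_def)
    then show ?thesis unfolding flags_def e by blast
  next
    assume "W \<subseteq> U \<and> card U = Suc (card W)"
    then have "W \<in> layer n i" "U \<in> layer n (Suc i)" "W \<subseteq> U" using cards sub by (auto simp: layer_def)
    then show ?thesis unfolding flags_def e by blast
  qed
next
  fix e assume "e \<in> flags n i"
  then obtain U W where e: "e = {U, W}" and UW: "U \<in> layer n i" "W \<in> layer n (Suc i)" "U \<subseteq> W"
    unfolding flags_def by blast
  have "sym_diff U W = W - U" using UW(3) by blast
  then have "card (sym_diff U W) = 1"
    using UW card_Diff_subset[OF finite_in_layer[OF UW(1)] UW(3)] by (simp only: layer_def) simp
  moreover have "U \<subseteq> {1..n}" "W \<subseteq> {1..n}" "card U = i" "card W = Suc i" using UW by (auto simp: layer_def)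
  ultimately show "e \<in> edges (boolean_layers n i (Suc i))"
    unfolding mem_edges_boolean_layers e by blast
qed

lemma flags_subset: "e \<in> flags n i \<Longrightarrow> e \<subseteq> layer n i \<union> layer n (Suc i)"
  by (auto simp: flags_def)

lemma finite_flags [simp]: "finite (flags n i)"
  by (rule finite_subset[of _ "Pow (layer n i \<union> layer n (Suc i))"]) (auto dest: flags_subset)

text \<open>The two non-membership facts tell the endpoints apart, so an endpoint known to lie in
  one layer is identified.\<close>

lemma flagE:
  assumes "e \<in> flags n i"
  obtains U W where "e = {U, W}" "U \<in> layer n i" "W \<in> layer n (Suc i)" "U \<subseteq> W"
    "U \<notin> layer n (Suc i)" "W \<notin> layer n i"
  using assms layer_disjoint[of n i] unfolding flags_def by blast

lemma card_flag:
  assumes "e \<in> flags n i"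
  shows "card e = 2"
proof (rule flagE[OF assms])
  fix U W assume "e = {U, W}" "U \<in> layer n i" "W \<notin> layer n i"
  then show ?thesis by (cases "U = W") auto
qed

section \<open>Degrees and number of edges\<close>

lemma flags_at_lower:
  assumes U: "U \<in> layer n i"
  shows "{e \<in> flags n i. U \<in> e} = (\<lambda>W. {U, W}) ` {W \<in> layer n (Suc i). U \<subseteq> W}"
proof (intro equalityI subsetI)
  fix e assume e: "e \<in> {e \<in> flags n i. U \<in> e}"
  then have "e \<in> flags n i" by simp
  then obtain U' W where UW: "e = {U', W}" "W \<in> layer n (Suc i)" "U' \<subseteq> W" "W \<notin> layer n i"
    by (rule flagE)
  then have "U = U'" using e U by auto
  then show "e \<in> (\<lambda>W. {U, W}) ` {W \<in> layer n (Suc i). U \<subseteq> W}" using UW by auto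
qed (use U in \<open>auto simp: flags_def\<close>)

lemma flags_at_upper:
  assumes W: "W \<in> layer n (Suc i)"
  shows "{e \<in> flags n i. W \<in> e} = (\<lambda>U. {U, W}) ` {U \<in> layer n i. U \<subseteq> W}"
proof (intro equalityI subsetI)
  fix e assume e: "e \<in> {e \<in> flags n i. W \<in> e}"
  then have "e \<in> flags n i" by simp
  then obtain U W' where UW: "e = {U, W'}" "U \<in> layer n i" "U \<subseteq> W'" "U \<notin> layer n (Suc i)"
    by (rule flagE)
  then have "W = W'" using e W by auto
  then show "e \<in> (\<lambda>U. {U, W}) ` {U \<in> layer n i. U \<subseteq> W}" using UW by auto
qed (use W in \<open>auto simp: flags_def\<close>)

lemma card_flags_at_lower:
  assumes "U \<in> layer n i"
  shows "card {e \<in> flags n i. U \<in> e} = n - i"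
  unfolding flags_at_lower[OF assms] card_upper_neighbours[OF assms, symmetric]
  by (rule card_image) (auto simp: inj_on_def doubleton_eq_iff)

lemma card_flags_at_upper:
  assumes "W \<in> layer n (Suc i)"
  shows "card {e \<in> flags n i. W \<in> e} = Suc i"
  unfolding flags_at_upper[OF assms] card_lower_neighbours[OF assms, symmetric]
  by (rule card_image) (auto simp: inj_on_def doubleton_eq_iff)

text \<open>Every flag has exactly one upper endpoint, so the flags are partitioned by it into
  classes of size i + 1.\<close>

lemma card_flags: "card (flags n i) = Suc i * (n choose Suc i)"
proof -
  have "flags n i = (\<Union>W\<in>layer n (Suc i). {e \<in> flags n i. W \<in> e})"
    by (auto elim: flagE)
  also have "card \<dots> = (\<Sum>W\<in>layer n (Suc i). card {e \<in> flags n i. W \<in> e})"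
  proof (rule card_UN_disjoint)
    have "W = W'" if "W \<in> layer n (Suc i)" "W' \<in> layer n (Suc i)" "e \<in> flags n i" "W \<in> e" "W' \<in> e"
      for W W' e
      using that(1,2,4,5) by (auto intro: flagE[OF that(3)])
    then show "\<forall>W\<in>layer n (Suc i). \<forall>W'\<in>layer n (Suc i). W \<noteq> W' \<longrightarrow>
        {e \<in> flags n i. W \<in> e} \<inter> {e \<in> flags n i. W' \<in> e} = {}"
      by blast
  qed auto
  also have "\<dots> = Suc i * (n choose Suc i)"
    by (simp add: card_flags_at_upper card_layer)
  finally show ?thesis .
qed

text \<open>The (u, v) entry counts the flags containing both u and v: the degree if u = v, none for
  distinct sets of one layer, and one across layers exactly under inclusion. Since n = 2i + 1, the
  lower degree n - i equals the upper degree i + 1, so both diagonal blocks carry the same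
  scalar.\<close>

lemma flag_incidence_mult_transpose:
  assumes fs: "enumerates fs (flags n i)" and us: "enumerates us (layer n i)"
    and ws: "enumerates ws (layer n (Suc i))" and n: "n = 2 * i + 1"
  shows "kernel_mat (us @ ws) fs incidence * transpose_mat (kernel_mat (us @ ws) fs incidence) =
    four_block_mat (of_nat (Suc i) \<cdot>\<^sub>m 1\<^sub>m (length us)) (inclusion_mat us ws)
      (transpose_mat (inclusion_mat us ws)) (of_nat (Suc i) \<cdot>\<^sub>m 1\<^sub>m (length ws))"
proof -
  let ?g = "\<lambda>u v. \<Sum>e\<in>flags n i. incidence u e * incidence v e"
  have set: "set us = layer n i" "set ws = layer n (Suc i)" "distinct us" "distinct ws"
    using us ws by (auto simp: enumerates_def)
  have g: "?g u v = of_nat (card {e \<in> flags n i. u \<in> e \<and> v \<in> e})" for u v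
    by (rule sum_incidence_edges) simp
  have at_lower: "{e \<in> flags n i. u \<in> e \<and> v \<in> e} =
      {e \<in> (\<lambda>W. {u, W}) ` {W \<in> layer n (Suc i). u \<subseteq> W}. v \<in> e}" if "u \<in> set us" for u v
    using that set(1) by (subst flags_at_lower[symmetric]) auto
  have at_upper: "{e \<in> flags n i. u \<in> e \<and> v \<in> e} =
      {e \<in> (\<lambda>U. {U, u}) ` {U \<in> layer n i. U \<subseteq> u}. v \<in> e}" if "u \<in> set ws" for u v
    using that set(2) by (subst flags_at_upper[symmetric]) auto
  have lower: "?g u v = (if u = v then of_nat (Suc i) else 0)" if "u \<in> set us" "v \<in> set us" for u v
  proof (cases "u = v")
    case True
    have "card {e \<in> flags n i. v \<in> e} = Suc i"
      using card_flags_at_lower[of v n i] that(2) n unfolding set by linarith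
    then show ?thesis unfolding g True by simp
  next
    case False
    then have "{e \<in> flags n i. u \<in> e \<and> v \<in> e} = {}"
      using that unfolding at_lower[OF that(1)] set by (auto simp: layer_def)
    then show ?thesis unfolding g using False by simp
  qed
  have upper: "?g u v = (if u = v then of_nat (Suc i) else 0)" if "u \<in> set ws" "v \<in> set ws" for u v
  proof (cases "u = v")
    case True
    have "card {e \<in> flags n i. v \<in> e} = Suc i"
      using card_flags_at_upper[of v n i] that(2) unfolding set .
    then show ?thesis unfolding g True by simp
  next
    case False
    then have "{e \<in> flags n i. u \<in> e \<and> v \<in> e} = {}"
      using that unfolding at_upper[OF that(1)] set by (auto simp: layer_def)
    then show ?thesis unfolding g using False by simp
  qed
  have mixed: "?g u v = incl u v" if "u \<in> set us" "v \<in> set ws" for u v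
  proof -
    have "u \<noteq> v" using that unfolding set by (auto simp: layer_def)
    then have "{e \<in> flags n i. u \<in> e \<and> v \<in> e} = (if u \<subseteq> v then {{u, v}} else {})"
      using that unfolding at_lower[OF that(1)] set by auto
    then show ?thesis unfolding g by (simp add: incl_def)
  qed
  have mixed': "?g v u = incl u v" if "u \<in> set us" "v \<in> set ws" for u v
    using mixed[OF that] by (simp add: mult.commute)
  have "kernel_mat us us ?g = of_nat (Suc i) \<cdot>\<^sub>m 1\<^sub>m (length us)"
    unfolding kernel_mat_scalar[OF set(3)] by (rule kernel_mat_cong) (rule lower)
  moreover have "kernel_mat ws ws ?g = of_nat (Suc i) \<cdot>\<^sub>m 1\<^sub>m (length ws)"
    unfolding kernel_mat_scalar[OF set(4)] by (rule kernel_mat_cong) (rule upper)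
  moreover have "kernel_mat us ws ?g = inclusion_mat us ws"
    unfolding inclusion_mat_def by (rule kernel_mat_cong) (rule mixed)
  moreover have "kernel_mat ws us ?g = transpose_mat (inclusion_mat us ws)"
    unfolding inclusion_mat_def kernel_mat_transpose by (rule kernel_mat_cong) (rule mixed')
  ultimately show ?thesis
    unfolding kernel_mat_transpose kernel_mat_mult[OF fs] kernel_mat_append by simp
qed

text \<open>With N sets in each middle layer there are 2N vertices and (i + 1)N edges. The product
  indexed by edges therefore has (i - 1)N additional zeros, which the shift by -2 turns into the
  eigenvalue -2.\<close>

lemma char_poly_line_graph_layers:
  assumes fs: "enumerates fs (flags n i)" and i: "i \<ge> 1" and n: "n = 2 * i + 1"
  shows "char_poly (adjacency_matrix (line_graph (boolean_layers n i (Suc i))) fs) =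
    [:2, 1:] ^ ((i - 1) * (n choose i)) *
    (\<Prod>j\<le>i. [:- (of_nat j - 2), 1:] ^ binom_diff n j *
      [:- (2 * of_nat (Suc i) - of_nat j - 2), 1:] ^ binom_diff n j)"
proof -
  define N where "N = n choose i"
  \<comment> \<open>The two middle layers have equal size, so \<open>C\<close> is square, as the
    block determinant requires.\<close>
  have N': "n choose Suc i = N" unfolding N_def n using binomial_symmetric[of i "2 * i + 1"] by simp
  let ?X = "[:0, 1:] :: complex poly"
  have "\<exists>vs. enumerates vs (layer n j)" for j
    using finite_distinct_list[OF finite_layer] unfolding enumerates_def by blast
  then obtain E where E: "\<And>j. enumerates (E j) (layer n j)" by metis
  let ?vs = "E i @ E (Suc i)"
  have vs: "enumerates ?vs (layer n i \<union> layer n (Suc i))"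
    using E[of i] E[of "Suc i"] layer_disjoint[of n i] by (auto simp: enumerates_def)
  have len: "length (E i) = N" "length (E (Suc i)) = N" "length fs = Suc i * N"
    using length_enumerates[OF E] length_enumerates[OF fs]
    by (simp_all add: card_layer card_flags N' N_def[symmetric])
  define B where "B = kernel_mat ?vs fs incidence"
  define C where "C = inclusion_mat (E i) (E (Suc i))"
  have B: "B \<in> carrier_mat (2 * N) (Suc i * N)"
    using kernel_mat_carrier[of ?vs fs incidence] by (simp add: B_def len mult_2)
  have C: "C \<in> carrier_mat N N"
    using kernel_mat_carrier[of "E i" "E (Suc i)" incl] by (simp add: C_def inclusion_mat_def len)
  have Bt: "transpose_mat B \<in> carrier_mat (Suc i * N) (2 * N)" using B by simp
  have Ct: "transpose_mat C \<in> carrier_mat N N" using C by simp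
  \<comment> \<open>For n = 2i + 1 the root is (i + 1 - j)^2, and (X - (i + 1))^2 - (i + 1 - j)^2
    splits as a difference of squares into (X - j)(X - (2(i + 1) - j)).\<close>
  have factor: "[:- ((of_nat i - of_nat j + 1) * (of_nat n - of_nat i - of_nat j)), 1 :: complex:] ^ m \<circ>\<^sub>p
      [:- of_nat (Suc i), 1:] ^ 2 = [:- of_nat j, 1:] ^ m * [:- (2 * of_nat (Suc i) - of_nat j), 1:] ^ m"
    for j m :: nat
  proof -
    have "[:- ((of_nat i - of_nat j + 1) * (of_nat n - of_nat i - of_nat j)), 1:] \<circ>\<^sub>p
      [:- of_nat (Suc i), 1:] ^ 2 = [:- of_nat j, 1:] * [:- (2 * of_nat (Suc i) - of_nat j), 1 :: complex:]"
      by (simp add: n pcompose_pCons power2_eq_square algebra_simps)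
    then show ?thesis by (simp only: pcompose_hom.hom_power power_mult_distrib)
  qed
  have "char_poly (B * transpose_mat B) = char_poly (C * transpose_mat C) \<circ>\<^sub>p [:- of_nat (Suc i), 1:] ^ 2"
    unfolding B_def flag_incidence_mult_transpose[OF fs E E n] len C_def[symmetric]
    by (rule char_poly_four_block_scalar_diagonal[OF C Ct])
  also have "char_poly (C * transpose_mat C) = (\<Prod>j\<le>i. [:- ((of_nat i - of_nat j + 1) *
      (of_nat n - of_nat i - of_nat j)), 1:] ^ binom_diff n j)"
    unfolding C_def using n by (intro char_poly_inclusion_mat E) simp
  finally have BBt: "char_poly (B * transpose_mat B) =
      (\<Prod>j\<le>i. [:- of_nat j, 1:] ^ binom_diff n j *
        [:- (2 * of_nat (Suc i) - of_nat j), 1:] ^ binom_diff n j)"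
    unfolding pcompose_prod factor .
  have "Suc i * N = 2 * N + (i - 1) * N"
    using i by (cases i) simp_all
  then have "?X ^ (Suc i * N) = ?X ^ (2 * N) * ?X ^ ((i - 1) * N)" by (simp only: power_add)
  then have "?X ^ (2 * N) * char_poly (transpose_mat B * B) =
      ?X ^ (2 * N) * (?X ^ ((i - 1) * N) * char_poly (B * transpose_mat B))"
    using char_poly_mult_commute[OF Bt B] by (simp only: mult.assoc)
  then have BtB: "char_poly (transpose_mat B * B) = ?X ^ ((i - 1) * N) * char_poly (B * transpose_mat B)"
    by (simp only: mult_cancel_left) simp
  have shift: "[:- a, 1:] ^ m \<circ>\<^sub>p [:- (- 2), 1:] = [:- (a - 2), 1:] ^ m" for a :: complex and m
    by (simp add: pcompose_hom.hom_power pcompose_pCons)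
  have shift0: "?X ^ m \<circ>\<^sub>p [:- (- 2), 1:] = [:2, 1:] ^ m" for m
    using shift[of 0 m] by simp
  have "adjacency_matrix (line_graph (boolean_layers n i (Suc i))) fs =
      transpose_mat B * B + (- 2) \<cdot>\<^sub>m 1\<^sub>m (Suc i * N)"
    unfolding B_def len(3)[symmetric]
    by (rule adjacency_matrix_line_graph[OF edges_boolean_layers fs vs])
      (simp add: flags_subset card_flag)
  then have "char_poly (adjacency_matrix (line_graph (boolean_layers n i (Suc i))) fs) =
      char_poly (transpose_mat B * B) \<circ>\<^sub>p [:- (- 2), 1:]"
    using char_poly_add_smult_one[OF mult_carrier_mat[OF Bt B], of "- 2"] by simp
  then show ?thesis
    unfolding BtB BBt pcompose_mult pcompose_prod shift shift0 N_def .
qed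

theorem theorem3p4:
  fixes k n :: nat
  assumes "k \<ge> 2" and "n = 2 * k - 1"
  shows "graph_spectrum (line_graph (boolean_layers n (k - 1) k)) =
      replicate_mset ((k - 2) * binom (2 * k - 1) (int k - 1) + 1) (- 2)
    + (\<Sum>i = 1..k - 1. replicate_mset
        (binom (2 * k - 1) (int i) - binom (2 * k - 1) (int i - 1)) (of_nat i - 2))
    + (\<Sum>i = 0..k - 1. replicate_mset
        (binom (2 * k - 1) (int i) - binom (2 * k - 1) (int i - 1)) (2 * of_nat k - of_nat i - 2))"
proof -
  define i where "i = k - 1"
  have k: "k = Suc i" "i \<ge> 1" "k - 2 = i - 1" "k - 1 = i" and n: "n = 2 * i + 1"
    using assms by (auto simp: i_def)
  have n': "2 * k - 1 = n" using assms by simp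
  let ?m = "binom_diff n"
  obtain fs where fs: "enumerates fs (flags n i)"
    using finite_distinct_list[OF finite_flags] unfolding enumerates_def by blast
  then have "enumerates fs (vertices (line_graph (boolean_layers n i (Suc i))))"
    by (simp add: line_graph_def vertices_def edges_boolean_layers)
  \<comment> \<open>The constant 2 is written as a double negation so that every factor has the form
    required by \<open>proots_linear_power\<close>.\<close>
  then have "graph_spectrum (line_graph (boolean_layers n i (Suc i))) =
      proots ([:- (- 2), 1:] ^ ((i - 1) * (n choose i)) *
        (\<Prod>j\<le>i. [:- (of_nat j - 2), 1:] ^ ?m j * [:- (2 * of_nat (Suc i) - of_nat j - 2), 1:] ^ ?m j))"
    by (simp add: graph_spectrum_eq char_poly_line_graph_layers[OF fs k(2) n])
  also have "\<dots> = replicate_mset ((i - 1) * (n choose i)) (- 2) +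
      (\<Sum>j\<le>i. replicate_mset (?m j) (of_nat j - 2) +
        replicate_mset (?m j) (2 * of_nat (Suc i) - of_nat j - 2))"
    by (subst proots_mult, simp, simp, subst proots_prod, simp, subst proots_mult, simp, simp)
      (simp only: proots_linear_power)
  also have "\<dots> = replicate_mset ((i - 1) * (n choose i)) (- 2) +
      (\<Sum>j = 0..i. replicate_mset (?m j) (of_nat j - 2)) +
      (\<Sum>j = 0..i. replicate_mset (?m j) (2 * of_nat (Suc i) - of_nat j - 2))"
    by (simp only: sum.distrib atMost_atLeast0 add.assoc)
  \<comment> \<open>The term j = 0 of the first family is the eigenvalue 0 - 2 with multiplicity 1.
    It joins the other copies of -2, which explains the \<open>+ 1\<close> in the multiplicity and
    the sum starting at 1.\<close>
  also have "(\<Sum>j = 0..i. replicate_mset (?m j) (of_nat j - 2)) =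
      replicate_mset 1 (- 2) + (\<Sum>j = 1..i. replicate_mset (?m j) (of_nat j - 2 :: complex))"
    by (simp add: sum.atLeast_Suc_atMost binom_diff_0)
  also have "replicate_mset ((i - 1) * (n choose i)) (- 2) + (replicate_mset 1 (- 2) +
      (\<Sum>j = 1..i. replicate_mset (?m j) (of_nat j - 2 :: complex))) =
      replicate_mset ((i - 1) * (n choose i) + 1) (- 2) +
      (\<Sum>j = 1..i. replicate_mset (?m j) (of_nat j - 2))"
    by simp
  also have "n choose i = binom n (int k - 1)"
    by (simp add: k(1) binom_def)
  finally show ?thesis
    unfolding n' k(3,4) k(1)[symmetric] binom_diff_def .
qed

end
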